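(* Let $\phi:\{1,\dots,n-1\} \to \mathbb{R}$ be a given function. Then the unique bounded function $f:\bar{\mathcal{R}}(n) \to \mathbb{R}$ satisfying $$\Delta f(x,y) = 0 \text{ in } \mathcal{R}(n),$$ $$f(x,y) = \begin{cases} \phi(y) & \text{on } \{(0,y):1\leq y \leq n-1\},\\ 0 & \text{on } \partial \mathcal{R}(n) \setminus \{(0,y):1\leq y \leq n-1\},\end{cases}$$ is given by $$f(x,y) = \sum_{j=1}^{n-1}b_j(\phi)\exp(-a_jx)\sin\Big(\frac{\pi yj}{n}\Big),$$ where $a_j$ is the positive solution of $\cosh(a_j) = 2 - \cos(\frac{\pi j}{n})$ and $$b_j(\phi)=\frac{2}{n-1}\sum_{y=1}^{n-1}\phi(y)\sin\Big(\frac{\pi yj}{n}\Big).$$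
   Context: Here $n$ is an integer and $\mathcal{R}(n)=\{(x,y) \in \mathbb{Z}^2:x \geq 1,\ 1 \leq y \leq n-1\}$ is the infinite discrete rectangle. The boundary of a set $D\subset\mathbb{Z}^2$ is $\partial D=\{w\in\mathbb{Z}^2: w\notin D,\ \exists z\in D \text{ with } |z-w|=1\}$ ($|\cdot|$ the Euclidean norm), and $\bar{\mathcal{R}}(n)=\mathcal{R}(n)\cup\partial\mathcal{R}(n)$. The discrete Laplacian is $\Delta f(x,y)=\frac14\sum (f(x',y')-f(x,y))$, the sum being over the four $(x',y')\in\mathbb{Z}^2$ with $|(x',y')-(x,y)|=1$.
   Formalization: The normalising factor in b_j(φ) is 2/n instead of the printed 2/(n-1), with which the formula gives n/(n-1)·φ(y) on the left side (for n=2, φ(1)=1 it gives f(0,1)=2). *)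

theory Defs
  imports "HOL-Analysis.Analysis"
begin

definition lattice_dist :: "int \<times> int \<Rightarrow> int \<times> int \<Rightarrow> real" where
  "lattice_dist z w = norm (real_of_int (fst z - fst w), real_of_int (snd z - snd w))"

lemma lattice_dist_eq_1_iff:
  "lattice_dist z w = 1 \<longleftrightarrow>
    w \<in> {(fst z + 1, snd z), (fst z - 1, snd z), (fst z, snd z + 1), (fst z, snd z - 1)}"
proof -
  obtain a b c d where z: "z = (a, b)" and w: "w = (c, d)"
    by (cases z, cases w)
  have "lattice_dist z w = 1 \<longleftrightarrow> real_of_int ((a - c)\<^sup>2 + (b - d)\<^sup>2) = real_of_int 1"
    by (simp add: z w lattice_dist_def norm_Pair)
  also have "\<dots> \<longleftrightarrow> (a - c)\<^sup>2 + (b - d)\<^sup>2 = 1"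
    by (simp only: of_int_eq_iff)
  also have "\<dots> \<longleftrightarrow> (\<bar>a - c\<bar> = 1 \<and> b = d) \<or> (a = c \<and> \<bar>b - d\<bar> = 1)"
  proof
    assume *: "(a - c)\<^sup>2 + (b - d)\<^sup>2 = 1"
    have "(a - c)\<^sup>2 = 0 \<or> (a - c)\<^sup>2 = 1"
      using * zero_le_power2[of "a - c"] zero_le_power2[of "b - d"] by linarith
    then show "(\<bar>a - c\<bar> = 1 \<and> b = d) \<or> (a = c \<and> \<bar>b - d\<bar> = 1)"
      using * by (auto simp: power2_eq_1_iff)
  next
    assume "(\<bar>a - c\<bar> = 1 \<and> b = d) \<or> (a = c \<and> \<bar>b - d\<bar> = 1)"
    then show "(a - c)\<^sup>2 + (b - d)\<^sup>2 = 1"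
      by (auto simp: power2_eq_1_iff abs_if split: if_splits)
  qed
  also have "\<dots> \<longleftrightarrow>
      w \<in> {(fst z + 1, snd z), (fst z - 1, snd z), (fst z, snd z + 1), (fst z, snd z - 1)}"
    by (auto simp: z w)
  finally show ?thesis .
qed

definition lattice_boundary :: "(int \<times> int) set \<Rightarrow> (int \<times> int) set" where
  "lattice_boundary D = {w. w \<notin> D \<and> (\<exists>z\<in>D. lattice_dist z w = 1)}"

definition rect :: "int \<Rightarrow> (int \<times> int) set" where
  "rect n = {(x, y). x \<ge> 1 \<and> 1 \<le> y \<and> y \<le> n - 1}"

definition rect_closure :: "int \<Rightarrow> (int \<times> int) set" where
  "rect_closure n = rect n \<union> lattice_boundary (rect n)"

definition left_side :: "int \<Rightarrow> (int \<times> int) set" where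
  "left_side n = {(0, y) | y. 1 \<le> y \<and> y \<le> n - 1}"

definition discrete_laplacian :: "(int \<times> int \<Rightarrow> real) \<Rightarrow> int \<times> int \<Rightarrow> real" where
  "discrete_laplacian f z = 1 / 4 * (\<Sum>w | lattice_dist z w = 1. f w - f z)"

text \<open>Functions on \<^term>\<open>rect_closure n\<close> are represented by the extensional function space
  \<open>\<rightarrow>\<^sub>E\<close>, so that equality of functions is equality on \<^term>\<open>rect_closure n\<close>.  All neighbours of
  points of \<^term>\<open>rect n\<close> lie in \<^term>\<open>rect_closure n\<close>.\<close>

definition bounded_dirichlet_solution ::
  "int \<Rightarrow> (int \<Rightarrow> real) \<Rightarrow> (int \<times> int \<Rightarrow> real) \<Rightarrow> bool" where
  "bounded_dirichlet_solution n \<phi> f \<longleftrightarrow>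
     f \<in> rect_closure n \<rightarrow>\<^sub>E UNIV \<and>
     bounded (f ` rect_closure n) \<and>
     (\<forall>z\<in>rect n. discrete_laplacian f z = 0) \<and>
     (\<forall>(x, y)\<in>left_side n. f (x, y) = \<phi> y) \<and>
     (\<forall>z\<in>lattice_boundary (rect n) - left_side n. f z = 0)"

definition decay_rate :: "int \<Rightarrow> int \<Rightarrow> real" where
  "decay_rate n j = (THE a. a > 0 \<and> cosh a = 2 - cos (pi * of_int j / of_int n))"

text \<open>The normalising factor is \<open>2 / n\<close>, because
  \<open>(\<Sum>y=1..n-1. sin (\<pi> y j / n)\<^sup>2) = n / 2\<close> for \<open>1 \<le> j \<le> n - 1\<close>.  The factor is sometimes given as
  \<open>2 / (n - 1)\<close>; with that value the formula fails to attain the boundary data \<open>\<phi>\<close> unless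
  \<open>\<phi> = 0\<close> (for \<open>n = 2\<close> it gives \<open>f (0, 1) = 2 * \<phi> 1\<close>).\<close>

definition sine_coeff :: "int \<Rightarrow> (int \<Rightarrow> real) \<Rightarrow> int \<Rightarrow> real" where
  "sine_coeff n \<phi> j =
     2 / of_int n * (\<Sum>y = 1..n - 1. \<phi> y * sin (pi * of_int y * of_int j / of_int n))"

end

theory Submission
  imports Defs
begin

text \<open>
  The sine transform in \<open>y\<close> diagonalises the problem.  For existence, every product
  \<open>exp (- a\<^sub>j x) sin (\<pi> j y / n)\<close> is harmonic by the choice of \<open>a\<^sub>j\<close>, and discrete orthogonality
  of the sines shows that the boundary data are attained at \<open>x = 0\<close>.  For uniqueness, the \<open>j\<close>-th
  sine coefficient \<open>G x\<close> of the difference of two solutions satisfies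
  \<open>G (x + 1) + G (x - 1) = 2 cosh a\<^sub>j G x\<close> and \<open>G 0 = 0\<close>.  As \<open>2 cosh a\<^sub>j > 2\<close>, the increments of
  \<open>\<bar>G\<bar>\<close> are nondecreasing, so a bounded \<open>G\<close> vanishes, and orthogonality again recovers the
  difference from its coefficients.
\<close>

section \<open>Discrete sines\<close>

lemma sum_telescope_int:
  fixes f :: "int \<Rightarrow> 'a::ab_group_add"
  assumes "m \<ge> 0"
  shows "(\<Sum>j = 1..m. f (j + 1) - f j) = f (m + 1) - f 1"
  using assms
proof (induction m rule: int_ge_induct)
  case base
  then show ?case by simp
next
  case (step i)
  have "{1..i + 1} = insert (i + 1) {1..i}"
    using step.hyps by auto
  then show ?case
    using step.IH by simp
qed

text \<open>With t = pi k / n, multiplying by 2 sin (t/2) makes the cosine sum telescope. The bounds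
  on \<open>k\<close> exclude the multiples of \<open>2 * n\<close>, which are exactly where sin
  (t/2) vanishes. The right-hand side depends only on the parity of \<open>k\<close>.\<close>

lemma sum_cos_multiples:
  fixes n k :: int
  assumes "n \<ge> 1" and "\<bar>k\<bar> < 2 * n" and "k \<noteq> 0"
  shows "2 * (\<Sum>j = 1..n - 1. cos (pi * of_int k * of_int j / of_int n)) = - cos (pi * of_int k) - 1"
proof -
  define t where "t = pi * of_int k / of_int n"
  have "sin (t / 2) \<noteq> 0"
  proof
    assume "sin (t / 2) = 0"
    then obtain i :: int where "t / 2 = of_int i * pi"
      by (auto simp: sin_zero_iff_int2)
    then have "of_int k = (of_int (2 * n * i) :: real)"
      using assms(1) by (simp add: t_def field_simps)
    then have "k = 2 * n * i"
      by (simp only: of_int_eq_iff)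
    then have "2 * n dvd k"
      by simp
    then have "\<bar>2 * n\<bar> \<le> \<bar>k\<bar>"
      using assms(3) dvd_imp_le_int by blast
    then show False
      using assms(1,2) by simp
  qed
  moreover have "2 * sin (t / 2) * (\<Sum>j = 1..n - 1. cos (t * of_int j))
      = sin (t / 2) * (- cos (pi * of_int k) - 1)"
  proof -
    \<comment> \<open>This is the sine at the half-integer point j - 1/2, so consecutive values
      differ by 2 sin (t/2) cos (t j).\<close>
    define h where "h j = sin (t * of_int j - t / 2)" for j :: int
    have "2 * sin (t / 2) * cos (t * of_int j) = h (j + 1) - h j" for j
    proof -
      have "h (j + 1) = sin (t * of_int j + t / 2)"
        unfolding h_def by (rule arg_cong[where f = sin]) (simp add: field_simps)
      then show ?thesis
        by (simp add: h_def sin_add sin_diff)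
    qed
    then have "2 * sin (t / 2) * (\<Sum>j = 1..n - 1. cos (t * of_int j))
        = (\<Sum>j = 1..n - 1. h (j + 1) - h j)"
      by (simp add: sum_distrib_left)
    also have "\<dots> = h n - h 1"
      using sum_telescope_int[of "n - 1" h] assms(1) by simp
    also have "h n = - cos (pi * of_int k) * sin (t / 2)"
      using assms(1) by (simp add: h_def t_def sin_diff)
    also have "h 1 = sin (t / 2)"
      by (simp add: h_def)
    finally show ?thesis
      by (simp add: algebra_simps)
  qed
  ultimately have "2 * (\<Sum>j = 1..n - 1. cos (t * of_int j)) = - cos (pi * of_int k) - 1"
    by (simp add: mult.commute mult.left_commute)
  then show ?thesis
    by (simp add: t_def)
qed

text \<open>Product-to-sum gives cosine sums of frequencies \<open>y - z\<close> and
  \<open>y + z\<close>. These have equal parity, so the sums cancel for distinct \<open>y\<close>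
  and \<open>z\<close>. For \<open>y = z\<close> they are n - 1 and -1, whose difference is twice
  the claimed n/2.\<close>

lemma sum_sin_orthogonal:
  fixes n y z :: int
  assumes y: "y \<in> {1..n - 1}" and z: "z \<in> {1..n - 1}"
  shows "(\<Sum>j = 1..n - 1. sin (pi * of_int y * of_int j / of_int n)
            * sin (pi * of_int z * of_int j / of_int n)) = (if y = z then of_int n / 2 else 0)"
proof -
  define C where "C k = (\<Sum>j = 1..n - 1. cos (pi * of_int k * of_int j / of_int n))" for k :: int
  have "2 * (\<Sum>j = 1..n - 1. sin (pi * of_int y * of_int j / of_int n)
            * sin (pi * of_int z * of_int j / of_int n)) = C (y - z) - C (y + z)"
    unfolding C_def sum_distrib_left sum_subtractf[symmetric]
    by (rule sum.cong)
       (simp_all add: sin_times_sin diff_divide_distrib add_divide_distrib algebra_simps)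
  moreover have "2 * C (y + z) = - cos (pi * of_int (y + z)) - 1"
    unfolding C_def using y z by (intro sum_cos_multiples) auto
  moreover have "2 * C (y - z) = - cos (pi * of_int (y - z)) - 1" if "y \<noteq> z"
    unfolding C_def using y z that by (intro sum_cos_multiples) auto
  moreover have "cos (pi * of_int (y + z)) = cos (pi * of_int (y - z))"
    by (simp add: distrib_left right_diff_distrib cos_add cos_diff)
  moreover have "cos (pi * of_int (y + z)) = 1" if "y = z"
    using that cos_double_sin[of "pi * of_int z"] by (simp add: algebra_simps)
  moreover have "C 0 = of_int n - 1"
    using y by (simp add: C_def)
  ultimately show ?thesis
    by (cases "y = z") auto
qed

text \<open>After the sums are swapped, orthogonality over the frequencies \<open>j\<close> keeps
  only the term z = y. Its value n/2 cancels the factor 2/n in \<open>sine_coeff\<close>.\<close>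

lemma sine_inversion:
  fixes n y :: int and u :: "int \<Rightarrow> real"
  assumes "y \<in> {1..n - 1}"
  shows "(\<Sum>j = 1..n - 1. sine_coeff n u j * sin (pi * of_int y * of_int j / of_int n)) = u y"
proof -
  define s where "s z j = sin (pi * of_int z * of_int j / of_int n)" for z j :: int
  have "(\<Sum>j = 1..n - 1. sine_coeff n u j * s y j)
      = (\<Sum>j = 1..n - 1. \<Sum>z = 1..n - 1. 2 / of_int n * u z * (s y j * s z j))"
    by (simp add: sine_coeff_def s_def sum_distrib_left sum_distrib_right mult_ac)
  also have "\<dots> = (\<Sum>z = 1..n - 1. 2 / of_int n * u z * (\<Sum>j = 1..n - 1. s y j * s z j))"
    by (subst sum.swap) (simp only: sum_distrib_left)
  also have "\<dots> = (\<Sum>z = 1..n - 1. if y = z then u z else 0)"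
    using assms by (intro sum.cong refl) (simp add: s_def sum_sin_orthogonal)
  also have "\<dots> = u y"
    using assms by simp
  finally show ?thesis
    by (simp add: s_def)
qed

lemma sine_coeff_add:
  "sine_coeff n (\<lambda>y. u y + v y) j = sine_coeff n u j + sine_coeff n v j"
  by (simp add: sine_coeff_def sum.distrib distrib_left distrib_right)

lemma sine_coeff_mult:
  "sine_coeff n (\<lambda>y. c * u y) j = c * sine_coeff n u j"
  by (simp add: sine_coeff_def sum_distrib_left mult_ac)

text \<open>The sines are eigenvectors of the vertical neighbour sum. Existence uses this directly,
  uniqueness through summation by parts.\<close>

lemma sin_multiple_neighbours:
  fixes n y j :: int
  shows "sin (pi * of_int (y + 1) * of_int j / of_int n) + sin (pi * of_int (y - 1) * of_int j / of_int n)
    = 2 * cos (pi * of_int j / of_int n) * sin (pi * of_int y * of_int j / of_int n)"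
proof -
  have "pi * of_int (y + 1) * of_int j / of_int n
      = pi * of_int y * of_int j / of_int n + pi * of_int j / of_int n"
    and "pi * of_int (y - 1) * of_int j / of_int n
      = pi * of_int y * of_int j / of_int n - pi * of_int j / of_int n"
    by (simp_all add: algebra_simps add_divide_distrib diff_divide_distrib)
  then show ?thesis
    by (simp only: sin_add sin_diff) simp
qed

text \<open>Summation by parts: the Casoratian of \<open>u\<close> and the sine telescopes.\<close>

lemma sine_coeff_neighbours:
  fixes n j :: int
  assumes n: "n \<ge> 1" and u: "u 0 = 0" "u n = 0"
  shows "sine_coeff n (\<lambda>y. u (y + 1) + u (y - 1)) j
    = 2 * cos (pi * of_int j / of_int n) * sine_coeff n u j"
proof -
  define s where "s y = sin (pi * of_int y * of_int j / of_int n)" for y :: int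
  define W where "W y = u y * s (y - 1) - u (y - 1) * s y" for y
  have "(\<Sum>y = 1..n - 1. (u (y + 1) + u (y - 1)) * s y - u y * (s (y + 1) + s (y - 1)))
      = (\<Sum>y = 1..n - 1. W (y + 1) - W y)"
    by (rule sum.cong) (simp_all add: W_def algebra_simps)
  also have "\<dots> = W n - W 1"
    using sum_telescope_int[of "n - 1" W] n by simp
  \<comment> \<open>Both \<open>u\<close> and \<open>s\<close> vanish at 0 and at n, which kills all
    four products in the end terms.\<close>
  also have "\<dots> = 0"
    using n u by (simp add: W_def s_def)
  finally have "(\<Sum>y = 1..n - 1. (u (y + 1) + u (y - 1)) * s y)
      = (\<Sum>y = 1..n - 1. u y * (s (y + 1) + s (y - 1)))"
    by (simp add: sum_subtractf)
  also have "\<dots> = 2 * cos (pi * of_int j / of_int n) * (\<Sum>y = 1..n - 1. u y * s y)"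
    unfolding s_def sin_multiple_neighbours by (simp add: sum_distrib_left mult_ac)
  finally show ?thesis
    by (simp add: sine_coeff_def s_def)
qed

section \<open>The decay rates\<close>

lemma cos_multiple_less_1:
  fixes n j :: int
  assumes "j \<in> {1..n - 1}"
  shows "cos (pi * of_int j / of_int n) < 1"
proof -
  have "cos (pi * of_int j / of_int n) < cos 0"
    using assms by (intro cos_monotone_0_pi) (auto simp: field_simps)
  then show ?thesis by simp
qed

text \<open>The angle lies strictly between 0 and pi, so the target exceeds 1, and cosh is strictly
  increasing on the nonnegative reals. Hence the definite description in \<open>decay_rate\<close>
  denotes.\<close>

lemma ex1_decay_rate:
  fixes n j :: int
  assumes "j \<in> {1..n - 1}"
  shows "\<exists>!a::real. a > 0 \<and> cosh a = 2 - cos (pi * of_int j / of_int n)"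
proof (rule ex_ex1I)
  have "1 < 2 - cos (pi * of_int j / of_int n)"
    using cos_multiple_less_1[OF assms] by simp
  then show "\<exists>a::real. a > 0 \<and> cosh a = 2 - cos (pi * of_int j / of_int n)"
    by (intro exI[of _ "arcosh (2 - cos (pi * of_int j / of_int n))"])
       simp
next
  fix a b :: real
  assume "a > 0 \<and> cosh a = 2 - cos (pi * of_int j / of_int n)"
    and "b > 0 \<and> cosh b = 2 - cos (pi * of_int j / of_int n)"
  then show "a = b"
    using cosh_real_strict_mono[of a b] cosh_real_strict_mono[of b a]
    by (cases a b rule: linorder_cases) auto
qed

lemma
  fixes n j :: int
  assumes "j \<in> {1..n - 1}"
  shows decay_rate_pos: "decay_rate n j > 0"
    and cosh_decay_rate: "cosh (decay_rate n j) = 2 - cos (pi * of_int j / of_int n)"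
  using theI'[OF ex1_decay_rate[OF assms]] by (simp_all add: decay_rate_def)

section \<open>The half-infinite rectangle\<close>

lemma discrete_laplacian_eq:
  "discrete_laplacian f (x, y)
    = 1 / 4 * (f (x + 1, y) + f (x - 1, y) + f (x, y + 1) + f (x, y - 1) - 4 * f (x, y))"
proof -
  have "{w. lattice_dist (x, y) w = 1} = {(x + 1, y), (x - 1, y), (x, y + 1), (x, y - 1)}"
    by (auto simp: lattice_dist_eq_1_iff)
  then show ?thesis
    by (simp add: discrete_laplacian_def)
qed

text \<open>The corners (0, 0) and (0, n) have no neighbour in the rectangle, hence
  \<open>x \<ge> 1\<close> on the horizontal sides. For n < 2 the rectangle and its boundary are
  empty, hence the conjunct \<open>n \<ge> 2\<close>.\<close>

lemma lattice_boundary_rect: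
  "lattice_boundary (rect n) = left_side n \<union> {(x, y). x \<ge> 1 \<and> (y = 0 \<or> y = n) \<and> n \<ge> 2}"
proof (rule set_eqI)
  fix w :: "int \<times> int"
  obtain x y where w: "w = (x, y)" by (cases w)
  have "w \<in> lattice_boundary (rect n) \<longleftrightarrow> w \<notin> rect n \<and>
      ((x + 1, y) \<in> rect n \<or> (x - 1, y) \<in> rect n \<or> (x, y + 1) \<in> rect n \<or> (x, y - 1) \<in> rect n)"
    (is "_ \<longleftrightarrow> ?R")
  proof
    assume "w \<in> lattice_boundary (rect n)"
    then show ?R
      by (auto simp: lattice_boundary_def lattice_dist_eq_1_iff w)
  next
    assume R: ?R
    then obtain z where "z \<in> rect n" "z \<in> {(x + 1, y), (x - 1, y), (x, y + 1), (x, y - 1)}"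
      by blast
    moreover from this have "lattice_dist z w = 1"
      by (auto simp: lattice_dist_eq_1_iff w)
    ultimately show "w \<in> lattice_boundary (rect n)"
      using R by (auto simp: lattice_boundary_def)
  qed
  then show "w \<in> lattice_boundary (rect n) \<longleftrightarrow>
      w \<in> left_side n \<union> {(x, y). x \<ge> 1 \<and> (y = 0 \<or> y = n) \<and> n \<ge> 2}"
    by (simp add: w rect_def left_side_def) presburger
qed

lemma rect_closure_eq:
  "rect_closure n = {(x, y). n \<ge> 2 \<and> (x \<ge> 1 \<and> 0 \<le> y \<and> y \<le> n \<or> x = 0 \<and> 1 \<le> y \<and> y \<le> n - 1)}"
  unfolding rect_closure_def lattice_boundary_rect by (auto simp: rect_def left_side_def)

section \<open>Uniqueness of bounded solutions\<close>

text \<open>By the triangle inequality and \<open>c \<ge> 2\<close>, each increment of the absolute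
  value is at least the previous one, so it is at least the first, \<open>\<bar>G 1\<bar>\<close>.
  The resulting linear growth contradicts boundedness unless \<open>G 1 = 0\<close>.\<close>

lemma bounded_recurrence_eq_0:
  fixes G :: "nat \<Rightarrow> real"
  assumes rec: "\<And>x. G (x + 2) + G x = c * G (x + 1)" and c: "c \<ge> 2"
    and G0: "G 0 = 0" and bdd: "bounded (range G)"
  shows "G x = 0"
proof -
  have incr: "\<bar>G (x + 1)\<bar> \<ge> \<bar>G x\<bar> + \<bar>G 1\<bar>" for x
  proof (induction x)
    case 0
    then show ?case by (simp add: G0)
  next
    case (Suc x)
    have "2 * \<bar>G (x + 1)\<bar> \<le> \<bar>c\<bar> * \<bar>G (x + 1)\<bar>"
      using c by (intro mult_right_mono) auto
    also have "\<dots> = \<bar>c * G (x + 1)\<bar>"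
      by (simp only: abs_mult)
    also have "\<dots> \<le> \<bar>G (x + 2)\<bar> + \<bar>G x\<bar>"
      unfolding rec[symmetric] by (rule abs_triangle_ineq)
    finally show ?case
      using Suc by simp
  qed
  have growth: "of_nat x * \<bar>G 1\<bar> \<le> \<bar>G x\<bar>" for x
  proof (induction x)
    case (Suc x)
    then show ?case
      using incr[of x] by (simp add: algebra_simps)
  qed simp
  obtain B where B: "\<And>x. \<bar>G x\<bar> \<le> B"
    using bdd by (auto simp: bounded_iff)
  have G1: "G 1 = 0"
  proof (rule ccontr)
    assume "G 1 \<noteq> 0"
    then obtain m :: nat where "B < of_nat m * \<bar>G 1\<bar>"
      using reals_Archimedean3[of "\<bar>G 1\<bar>"] by auto
    then show False
      using growth[of m] B[of m] by simp
  qed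
  \<comment> \<open>The recurrence has order two, so the induction carries two consecutive
    values.\<close>
  have "G x = 0 \<and> G (x + 1) = 0"
  proof (induction x)
    case (Suc x)
    then show ?case
      using rec[of x] by simp
  qed (simp add: G0 G1[simplified])
  then show ?thesis by simp
qed

text \<open>On the \<open>j\<close>-th sine coefficient of a column, the vertical neighbour sum acts
  as multiplication by 2 cos (pi j / n). Harmonicity thus becomes a scalar recurrence along
  \<open>x\<close> for each \<open>j\<close>.\<close>

lemma bounded_harmonic_eq_0:
  fixes g :: "int \<times> int \<Rightarrow> real"
  assumes harm: "\<And>z. z \<in> rect n \<Longrightarrow> discrete_laplacian g z = 0"
    and bdry: "\<And>z. z \<in> lattice_boundary (rect n) \<Longrightarrow> g z = 0"
    and bdd: "bounded (g ` rect_closure n)"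
    and z: "z \<in> rect_closure n"
  shows "g z = 0"
proof (cases "z \<in> rect n")
  case False
  then show ?thesis
    using z bdry by (auto simp: rect_closure_def)
next
  case True
  obtain x y where xy: "z = (x, y)" by (cases z)
  have y: "y \<in> {1..n - 1}" and x: "x \<ge> 1"
    using True by (auto simp: xy rect_def)
  then have n: "n \<ge> 2" by simp
  obtain B where B: "\<And>w. w \<in> rect_closure n \<Longrightarrow> \<bar>g w\<bar> \<le> B"
    using bdd by (auto simp: bounded_iff)
  define G where "G j m = sine_coeff n (\<lambda>y. g (int m, y)) j" for j m
  have "G j m = 0" if j: "j \<in> {1..n - 1}" for j m
  proof (rule bounded_recurrence_eq_0)
    define c where "c = cos (pi * of_int j / of_int n)"
    \<comment> \<open>The 4 comes from the centre of the Laplacian and 2c from the vertical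
      neighbours.\<close>
    show "4 - 2 * c \<ge> 2"
      by (simp add: c_def)
    show "G j 0 = 0"
      using bdry by (simp add: G_def sine_coeff_def lattice_boundary_rect left_side_def)
    show "G j (k + 2) + G j k = (4 - 2 * c) * G j (k + 1)" for k
    proof -
      \<comment> \<open>The middle column has x = k + 1 >= 1. There harmonicity holds at the
        interior points and both end points are boundary points, whereas column 0 would end in the
        excluded corners.\<close>
      define u where "u = (\<lambda>y. g (int (k + 1), y))"
      have u: "u 0 = 0" "u n = 0"
        using n by (auto simp: u_def lattice_boundary_rect intro!: bdry)
      have eq: "g (int (k + 2), y) + g (int k, y) + (u (y + 1) + u (y - 1)) = 4 * u y"
        if "y \<in> {1..n - 1}" for y
      proof -
        have "discrete_laplacian g (int (k + 1), y) = 0"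
          using that by (intro harm) (auto simp: rect_def)
        then show ?thesis
          by (simp add: discrete_laplacian_eq u_def add_ac)
      qed
      \<comment> \<open>\<open>sine_coeff\<close> reads only the values at 1, ..., n - 1, where
        \<open>eq\<close> is available.\<close>
      have "sine_coeff n (\<lambda>y. g (int (k + 2), y) + g (int k, y) + (u (y + 1) + u (y - 1))) j
          = sine_coeff n (\<lambda>y. 4 * u y) j"
        using eq by (simp add: sine_coeff_def)
      then have "G j (k + 2) + G j k + 2 * c * G j (k + 1) = 4 * G j (k + 1)"
        using sine_coeff_neighbours[of n u j] n u
        by (simp add: sine_coeff_add sine_coeff_mult G_def c_def u_def)
      then show ?thesis
        by (simp add: algebra_simps)
    qed
    show "bounded (range (G j))"
    proof (rule boundedI)
      fix r assume "r \<in> range (G j)"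
      then obtain m where r: "r = G j m" by auto
      have "\<bar>\<Sum>y = 1..n - 1. g (int m, y) * sin (pi * of_int y * of_int j / of_int n)\<bar>
          \<le> (\<Sum>y = 1..n - 1. B)"
      proof (rule order_trans[OF sum_abs sum_mono])
        fix y assume "y \<in> {1..n - 1}"
        then have "\<bar>g (int m, y)\<bar> \<le> B"
          by (intro B) (auto simp: rect_closure_eq)
        moreover have "\<bar>sin (pi * of_int y * of_int j / of_int n)\<bar> \<le> 1"
          by (rule abs_sin_le_one)
        ultimately have "\<bar>g (int m, y)\<bar> * \<bar>sin (pi * of_int y * of_int j / of_int n)\<bar> \<le> B * 1"
          by (rule mult_mono') (rule abs_ge_zero)+
        then show "\<bar>g (int m, y) * sin (pi * of_int y * of_int j / of_int n)\<bar> \<le> B"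
          by (simp only: abs_mult mult_1_right)
      qed
      then have "2 / of_int n * \<bar>\<Sum>y = 1..n - 1. g (int m, y) * sin (pi * of_int y * of_int j / of_int n)\<bar>
          \<le> 2 / of_int n * (\<Sum>y = 1..n - 1. B)"
        by (rule mult_left_mono) (use n in simp)
      moreover have "\<bar>2 / of_int n :: real\<bar> = 2 / of_int n"
        using n by simp
      ultimately have "\<bar>G j m\<bar> \<le> 2 / of_int n * (\<Sum>y = 1..n - 1. B)"
        by (simp only: G_def sine_coeff_def abs_mult)
      then show "norm r \<le> 2 / of_int n * (\<Sum>y = 1..n - 1. B)"
        by (simp add: r)
    qed
  qed
  from this[of _ "nat x"] have "sine_coeff n (\<lambda>y. g (x, y)) j = 0" if "j \<in> {1..n - 1}" for j
    using that x by (simp add: G_def)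
  then show ?thesis
    using sine_inversion[OF y, of "\<lambda>y. g (x, y)"] by (simp add: xy)
qed

lemma bounded_dirichlet_solution_unique:
  assumes f: "bounded_dirichlet_solution n \<phi> f" and g: "bounded_dirichlet_solution n \<phi> g"
  shows "f = g"
proof (rule PiE_ext)
  show "f \<in> rect_closure n \<rightarrow>\<^sub>E UNIV" "g \<in> rect_closure n \<rightarrow>\<^sub>E UNIV"
    using f g by (auto simp: bounded_dirichlet_solution_def)
next
  fix z assume z: "z \<in> rect_closure n"
  have "f z - g z = 0"
  proof (rule bounded_harmonic_eq_0[where g = "\<lambda>z. f z - g z" and n = n])
    fix w assume "w \<in> rect n"
    then have "discrete_laplacian f w = 0" "discrete_laplacian g w = 0"
      using f g by (auto simp: bounded_dirichlet_solution_def)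
    then show "discrete_laplacian (\<lambda>z. f z - g z) w = 0"
      by (cases w) (simp add: discrete_laplacian_eq)
  next
    fix w assume w: "w \<in> lattice_boundary (rect n)"
    show "f w - g w = 0"
    proof (cases "w \<in> left_side n")
      case True
      then show ?thesis
        using f g by (fastforce simp: bounded_dirichlet_solution_def)
    next
      case False
      then show ?thesis
        using f g w by (auto simp: bounded_dirichlet_solution_def)
    qed
  next
    show "bounded ((\<lambda>z. f z - g z) ` rect_closure n)"
      using f g by (intro bounded_minus_comp) (auto simp: bounded_dirichlet_solution_def)
  qed (rule z)
  then show "f z = g z" by simp
qed

section \<open>Existence by the sine series\<close>

lemma bounded_dirichlet_solution_sine_series:
  fixes n :: int and \<phi> :: "int \<Rightarrow> real"
  shows "bounded_dirichlet_solution n \<phi>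
      (\<lambda>(x, y)\<in>rect_closure n.
         \<Sum>j = 1..n - 1. sine_coeff n \<phi> j * exp (- decay_rate n j * of_int x)
                          * sin (pi * of_int y * of_int j / of_int n))"
proof -
  define s where "s y j = sin (pi * of_int y * of_int j / of_int n)" for y j :: int
  define E where "E j x = exp (- decay_rate n j * of_int x)" for j x :: int
  define F where "F x y = (\<Sum>j = 1..n - 1. sine_coeff n \<phi> j * E j x * s y j)" for x y
  define f where "f = (\<lambda>(x, y)\<in>rect_closure n. F x y)"
  have f: "f (x, y) = F x y" if "(x, y) \<in> rect_closure n" for x y
    using that by (simp add: f_def)
  have "discrete_laplacian f z = 0" if "z \<in> rect n" for z
  proof -
    obtain x y where xy: "z = (x, y)" by (cases z)
    \<comment> \<open>Each summand is harmonic by itself: horizontal neighbours contribute the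
      factor 2 cosh a_j = 4 - 2 cos (pi j / n), vertical ones 2 cos (pi j / n), and these add up to
      4.\<close>
    have term_eq: "sine_coeff n \<phi> j * E j (x + 1) * s y j + sine_coeff n \<phi> j * E j (x - 1) * s y j
        + sine_coeff n \<phi> j * E j x * s (y + 1) j + sine_coeff n \<phi> j * E j x * s (y - 1) j
        - 4 * (sine_coeff n \<phi> j * E j x * s y j) = 0" if "j \<in> {1..n - 1}" for j
    proof -
      have "E j (x + 1) + E j (x - 1) = 2 * cosh (decay_rate n j) * E j x"
        by (simp add: E_def cosh_def exp_add exp_diff exp_minus algebra_simps divide_simps)
      then have E: "E j (x + 1) = 2 * (2 - cos (pi * of_int j / of_int n)) * E j x - E j (x - 1)"
        using cosh_decay_rate[OF that] by simp
      have s: "s (y + 1) j = 2 * cos (pi * of_int j / of_int n) * s y j - s (y - 1) j"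
        using sin_multiple_neighbours[of y j n] by (simp add: s_def)
      show ?thesis
        unfolding E s by algebra
    qed
    have "F (x + 1) y + F (x - 1) y + F x (y + 1) + F x (y - 1) - 4 * F x y
        = (\<Sum>j = 1..n - 1. 0)"
      unfolding F_def sum_distrib_left sum.distrib[symmetric] sum_subtractf[symmetric]
      by (rule sum.cong[OF refl], rule term_eq)
    \<comment> \<open>The restricted function is known to agree with \<open>F\<close> only on the
      closure, which contains every neighbour of a point of the rectangle.\<close>
    moreover have "f (x + 1, y) = F (x + 1) y" "f (x - 1, y) = F (x - 1) y"
      "f (x, y + 1) = F x (y + 1)" "f (x, y - 1) = F x (y - 1)" "f (x, y) = F x y"
      using that by (auto simp: xy rect_def rect_closure_eq intro!: f)
    ultimately show ?thesis
      by (simp add: xy discrete_laplacian_eq)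
  qed
  moreover have "f (x, y) = \<phi> y" if "(x, y) \<in> left_side n" for x y
  proof -
    have "x = 0" "y \<in> {1..n - 1}"
      using that by (auto simp: left_side_def)
    then show ?thesis
      \<comment> \<open>At x = 0 the exponentials are 1, leaving the inversion formula.\<close>
      using sine_inversion[of y n \<phi>]
      by (subst f) (auto simp: rect_closure_eq F_def E_def s_def)
  qed
  moreover have "f z = 0" if "z \<in> lattice_boundary (rect n) - left_side n" for z
  proof -
    obtain x y where xy: "z = (x, y)" by (cases z)
    then have z: "x \<ge> 1" "y = 0 \<or> y = n" "n \<ge> 2"
      using that by (auto simp: lattice_boundary_rect)
    then have "s y j = 0" for j
      by (auto simp: s_def)
    moreover have "(x, y) \<in> rect_closure n"
      using z by (auto simp: rect_closure_eq)
    ultimately show ?thesis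
      using f by (simp add: xy F_def)
  qed
  moreover have "bounded (f ` rect_closure n)"
  proof (rule boundedI)
    fix r assume "r \<in> f ` rect_closure n"
    then obtain x y where xy: "(x, y) \<in> rect_closure n" "r = F x y"
      using f by auto
    have x: "x \<ge> 0"
      using xy(1) by (auto simp: rect_closure_eq)
    \<comment> \<open>Since x >= 0 on the closure, the exponentials are at most 1, so the bound is
      independent of the point.\<close>
    have "\<bar>F x y\<bar> \<le> (\<Sum>j = 1..n - 1. \<bar>sine_coeff n \<phi> j\<bar>)"
      unfolding F_def
    proof (rule order_trans[OF sum_abs sum_mono])
      fix j assume "j \<in> {1..n - 1}"
      then have "0 \<le> E j x" "E j x \<le> 1"
        using decay_rate_pos[of j n] x by (auto simp: E_def)
      moreover have "\<bar>s y j\<bar> \<le> 1"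
        by (simp add: s_def)
      ultimately have "E j x * \<bar>s y j\<bar> \<le> 1"
        by (intro mult_le_one) auto
      then show "\<bar>sine_coeff n \<phi> j * E j x * s y j\<bar> \<le> \<bar>sine_coeff n \<phi> j\<bar>"
        using \<open>0 \<le> E j x\<close> by (simp add: abs_mult mult.assoc mult_left_le)
    qed
    then show "norm r \<le> (\<Sum>j = 1..n - 1. \<bar>sine_coeff n \<phi> j\<bar>)"
      by (simp add: xy(2))
  qed
  moreover have "f \<in> rect_closure n \<rightarrow>\<^sub>E UNIV"
    by (simp add: f_def)
  ultimately have "bounded_dirichlet_solution n \<phi> f"
    by (auto simp: bounded_dirichlet_solution_def)
  then show ?thesis
    by (simp add: f_def F_def E_def s_def)
qed

theorem lemma6p3:
  fixes n :: int and \<phi> :: "int \<Rightarrow> real"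
  shows "(\<forall>j\<in>{1..n - 1}. \<exists>!a::real. a > 0 \<and> cosh a = 2 - cos (pi * of_int j / of_int n)) \<and>
    (\<exists>!f. bounded_dirichlet_solution n \<phi> f) \<and>
    bounded_dirichlet_solution n \<phi>
      (\<lambda>(x, y)\<in>rect_closure n.
         \<Sum>j = 1..n - 1. sine_coeff n \<phi> j * exp (- decay_rate n j * of_int x)
                          * sin (pi * of_int y * of_int j / of_int n))"
  using ex1_decay_rate bounded_dirichlet_solution_sine_series bounded_dirichlet_solution_unique
  by blast

end
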